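(* For any positive integers $t$ and $n\ge2$, there exist an alphabet $\mathcal X$ and a $t$-histogram distribution $p$ over $\mathcal X$ such that \[ H^{\mathcal S}_n(p)\ge\tilde\Omega\left(\min\left\{(nt^2)^{\frac13},\sqrt n\right\}\right). \]
   Context: A distribution $p$ over $\mathcal X$ is a $t$-histogram distribution if there is a partition of $\mathcal X$ into $t$ parts such that $p$ has the same probability value on all symbols within each part. For integers $j\ge1$ let $I_j:=\left((j-1)^2\frac{\log n}{n},\ j^2\frac{\log n}{n}\right]$, let $p_{I_j}$ be the number of symbols $x\in\mathcal X$ with $p_x\in I_j$, and define $H^{\mathcal S}_n(p):=\sum_{j\ge1}\min\{p_{I_j},\ j\cdot\log n\}$. $\log$ is the natural logarithm. $\tilde\Omega(A)$ denotes a quantity at least $cA/(1+\log n)^{C}$ with absolute constants $c,C>0$. *)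

theory Defs
  imports "HOL-Probability.Probability"
begin

text \<open>
  A distribution over an alphabet \<open>X\<close> is a \<open>pmf\<close> whose support is contained in \<open>X\<close>;
  symbols of \<open>X\<close> may have probability zero.  As usual for partitions, the parts
  are nonempty, so a \<open>t\<close>-histogram needs at least \<open>t\<close> symbols.
\<close>

definition histogram_distribution :: "nat \<Rightarrow> 'a set \<Rightarrow> 'a pmf \<Rightarrow> bool" where
  "histogram_distribution t X p \<longleftrightarrow>
     set_pmf p \<subseteq> X \<and>
     (\<exists>P. partition_on X P \<and> finite P \<and> card P = t \<and>
          (\<forall>A\<in>P. \<forall>x\<in>A. \<forall>y\<in>A. pmf p x = pmf p y))"

definition prob_interval :: "nat \<Rightarrow> nat \<Rightarrow> real set" where
  "prob_interval n j =
     {(real j - 1)^2 * (ln (real n) / real n) <.. (real j)^2 * (ln (real n) / real n)}"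

text \<open>
  Only meaningful for finite \<open>X\<close>, because \<open>card\<close> of an infinite set is \<open>0\<close>.
\<close>

definition symbol_count :: "nat \<Rightarrow> 'a set \<Rightarrow> 'a pmf \<Rightarrow> nat \<Rightarrow> nat" where
  "symbol_count n X p j = card {x \<in> X. pmf p x \<in> prob_interval n j}"

text \<open>
  For \<open>n \<ge> 2\<close> only finitely many summands are nonzero: \<open>prob_interval n j\<close> lies above \<open>1\<close>
  for all large \<open>j\<close>.
\<close>

definition HS :: "nat \<Rightarrow> 'a set \<Rightarrow> 'a pmf \<Rightarrow> real" where
  "HS n X p =
     (\<Sum>\<^sub>\<infinity>j\<in>{1..}. min (real (symbol_count n X p j)) (real j * ln (real n)))"

end

theory Submission imports Defs begin

text \<open>
  Take \<open>T \<le> t\<close> blocks of \<open>s\<close> symbols each, where the symbols of block \<open>i\<close> have probability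
  proportional to \<open>(s + i)\<^sup>2\<close>.  If the normalising constant \<open>W = \<Sum>\<^sub>i s (s + i)\<^sup>2\<close> is at most
  \<open>n / log n\<close>, then, in units of \<open>log n / n\<close>, the square roots of the block probabilities
  are at least \<open>1\<close> apart and at least \<open>s\<close>.  Hence the blocks fall into different
  intervals \<open>I\<^sub>j\<close> with \<open>j \<ge> s\<close>, and each contributes at least a constant multiple of \<open>s\<close>.
  Up to logarithms the constraint on \<open>W\<close> allows \<open>T \<approx> min {t, n\<^bsup>1/4\<^esup>}\<close> and
  \<open>s \<approx> (n / T)\<^bsup>1/3\<^esup> \<ge> T\<close>, so that \<open>T s \<approx> (n T\<^sup>2)\<^bsup>1/3\<^esup>\<close>.  Symbols of probability zero bring
  the number of parts up to \<open>t\<close>.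
\<close>

section \<open>Bounding \<open>HS\<close> from below; building histogram distributions\<close>

text \<open>The value of an infinite sum says nothing unless the family is summable. Here it is:
  once \<open>(j - 1)^2\<close> times \<open>ln n / n\<close> exceeds 1, no probability lies in the
  interval, so all summands with \<open>j \<ge> K + 2\<close> vanish.\<close>

lemma sum_le_HS:
  assumes n: "n \<ge> 2" and J: "finite J" "J \<subseteq> {1..}"
  shows "(\<Sum>j\<in>J. min (real (symbol_count n X p j)) (real j * ln (real n))) \<le> HS n X p"
proof -
  let ?f = "\<lambda>j. min (real (symbol_count n X p j)) (real j * ln (real n))"
  have l: "ln (real n) / real n > 0" using n by simp
  obtain K :: nat where K: "1 / (ln (real n) / real n) < real K"
    using reals_Archimedean2 by blast
  have zero: "?f j = 0" if j: "j \<ge> K + 2" for j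
  proof -
    have "1 < real K * (ln (real n) / real n)"
      using K l pos_divide_less_eq[OF l] by blast
    also have "real K \<le> (real j - 1)^2"
    proof -
      have "real K \<le> real j - 1" "1 \<le> real j - 1" using j by linarith+
      then show ?thesis using self_le_power[of "real j - 1" 2] by linarith
    qed
    finally have "1 < (real j - 1)^2 * (ln (real n) / real n)"
      using l by (simp only: mult_right_mono less_imp_le)
    then have "{x \<in> X. pmf p x \<in> prob_interval n j} = {}"
      using order.strict_trans2[OF _ pmf_le_1[of p]]
      by (auto simp only: prob_interval_def greaterThanAtMost_iff dest: order.strict_trans)
    then have "symbol_count n X p j = 0" by (simp only: symbol_count_def card.empty)
    then show ?thesis using n by simp
  qed
  have "?f summable_on {1..}"
  proof -
    have "?f summable_on {1..K+2}" by simp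
    then show ?thesis
      by (rule summable_on_cong_neutral[THEN iffD1, rotated -1]) (use zero in auto)
  qed
  then show ?thesis
    unfolding HS_def by (rule finite_sum_le_infsum) (use J n in auto)
qed

text \<open>The parts are the fibres of \<open>key\<close>. Surjectivity onto \<open>{..<t}\<close>
  makes them nonempty, hence pairwise distinct, so there are exactly \<open>t\<close> of
  them.\<close>

lemma histogram_distributionI:
  assumes "set_pmf p \<subseteq> X" "key ` X = {..<t}"
    and "\<And>x y. x \<in> X \<Longrightarrow> y \<in> X \<Longrightarrow> key x = key y \<Longrightarrow> pmf p x = pmf p y"
  shows "histogram_distribution t X p"
proof -
  let ?A = "\<lambda>i. {x \<in> X. key x = i}"
  have ne: "?A i \<noteq> {}" if "i < t" for i
    proof -
    from that have "i \<in> key ` X" by (simp add: assms(2))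
    then show ?thesis by auto
  qed
  have inj: "inj_on ?A {..<t}"
    using ne by (intro inj_onI) blast
  have "partition_on X (?A ` {..<t})"
    using ne assms(2) by (intro partition_onI) (auto simp: disjnt_def)
  moreover have "card (?A ` {..<t}) = t" using card_image[OF inj] by simp
  ultimately show ?thesis
    unfolding histogram_distribution_def using assms(1,3)
    by (intro conjI exI[of _ "?A ` {..<t}"]) auto
qed

lemma pmf_proportional:
  fixes w :: "nat \<Rightarrow> real"
  assumes "\<And>x. x < m \<Longrightarrow> w x \<ge> 0" and W: "(\<Sum>x<m. w x) > 0"
  obtains p where "\<And>x. pmf p x = (if x < m then w x / (\<Sum>x<m. w x) else 0)"
proof
  let ?W = "\<Sum>x<m. w x"
  let ?f = "\<lambda>x. if x < m then w x / ?W else 0"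
  have "(\<integral>\<^sup>+ x. ennreal (?f x) \<partial>count_space UNIV) = (\<Sum>x<m. ennreal (?f x))"
    by (intro nn_integral_count_space') auto
  also have "\<dots> = ennreal (\<Sum>x<m. ?f x)"
    using assms by (intro sum_ennreal) auto
  also have "(\<Sum>x<m. ?f x) = 1"
    using W by (simp flip: sum_divide_distrib)
  finally show "pmf (embed_pmf ?f) x = ?f x" for x
    using assms by (intro pmf_embed_pmf) auto
qed

section \<open>The block distribution\<close>

lemma block_distribution:
  fixes t n T s :: nat
  assumes n: "n \<ge> 2" and T: "1 \<le> T" "T \<le> t" and s: "s \<ge> 1"
    and small: "real T * real s * (real s + real T - 1)^2 * ln (real n) \<le> real n"
  shows "\<exists>(X :: nat set) p. finite X \<and> histogram_distribution t X p \<and>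
           HS n X p \<ge> ln 2 * (real T * real s)"
proof -
  define m where "m = T * s"
  define w where "w x = (real (s + x div s))^2" for x
  define W where "W = (\<Sum>x<m. w x)"
  define u where "u = ln (real n) / real n"
  \<comment> \<open>The first \<open>m\<close> symbols carry all the mass. Each of the
    \<open>t - T\<close> others has probability zero and forms a part by itself, numbered by
    \<open>key\<close> from \<open>T\<close> on.\<close>
  define X where "X = {..<m + (t - T)}"
  define key where "key x = (if x < m then x div s else x - m + T)" for x
  have m: "m \<ge> 1" using T s by (simp add: m_def)
  have divT: "x div s < T" if "x < m" for x
    using that s by (simp add: m_def less_mult_imp_div_less)
  have wpos: "w x > 0" for x using s by (simp add: w_def)
  have W: "W > 0" unfolding W_def using m wpos by (intro sum_pos) (auto simp: lessThan_empty_iff)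
  have u: "u > 0" using n by (simp add: u_def)
  have Wle: "W * u \<le> 1"
  proof -
    have "W \<le> real m * (real s + real T - 1)^2"
      unfolding W_def
    proof (rule order.trans[OF sum_bounded_above])
      show "w x \<le> (real s + real T - 1)^2" if "x \<in> {..<m}" for x
        unfolding w_def using divT[of x] that by (intro power_mono) auto
    qed simp
    then have "W * ln (real n) \<le> real T * real s * (real s + real T - 1)^2 * ln (real n)"
      using n by (simp add: m_def mult_right_mono)
    with small have "W * ln (real n) \<le> real n" by linarith
    then show ?thesis using n by (simp add: u_def)
  qed
  obtain p where p: "\<And>x. pmf p x = (if x < m then w x / W else 0)"
    using pmf_proportional[of m w] wpos W unfolding W_def by (metis less_imp_le)

  have hist: "histogram_distribution t X p"
  proof (rule histogram_distributionI[where key = key])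
    show "set_pmf p \<subseteq> X" by (auto simp: set_pmf_eq p X_def split: if_splits)
    show "key ` X = {..<t}"
    proof (intro set_eqI iffI)
      fix i assume "i \<in> key ` X"
      then show "i \<in> {..<t}" using T divT by (fastforce simp: key_def X_def split: if_splits)
    next
      fix i assume i: "i \<in> {..<t}"
      show "i \<in> key ` X"
      proof (cases "i < T")
        case True
        then have "i * s < m" using s by (simp add: m_def)
        with s show ?thesis by (intro image_eqI[of _ _ "i * s"]) (auto simp: key_def X_def)
      next
        case False
        with i show ?thesis by (intro image_eqI[of _ _ "m + (i - T)"]) (auto simp: key_def X_def)
      qed
    qed
    show "pmf p x = pmf p y" if "x \<in> X" "y \<in> X" "key x = key y" for x y
      using that divT[of x] divT[of y] by (auto simp: p w_def key_def split: if_splits)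
  qed

  \<comment> \<open>\<open>a i\<close> is the square root of the probability of a symbol of block
    \<open>i\<close> in units of \<open>u\<close>. The intervals are open on the left and closed on
    the right, so the ceiling \<open>J i\<close> is the index of its interval.\<close>
  define a where "a i = real (s + i) / sqrt (W * u)" for i
  define J where "J i = nat \<lceil>a i\<rceil>" for i
  have q: "0 < sqrt (W * u)" "sqrt (W * u) \<le> 1" using W u Wle by auto
  have a_ge: "a i \<ge> real (s + i)" for i
    using q by (simp add: a_def le_divide_eq mult_left_le)
  have J_ge: "J i \<ge> s" for i using a_ge[of i] unfolding J_def by linarith
  have J_less: "J i < J k" if "i < k" for i k
  proof -
    \<comment> \<open>Dividing by \<open>sqrt (W * u) \<le> 1\<close> can only widen the gaps
      between the integers \<open>s + i\<close>; reals at least 1 apart have different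
      ceilings.\<close>
    have "a k - a i = (real k - real i) / sqrt (W * u)"
      by (simp add: a_def diff_divide_distrib add_divide_distrib)
    also have "\<dots> \<ge> 1"
    proof -
      have "sqrt (W * u) \<le> real k - real i" using q that by linarith
      then show ?thesis using q by (simp only: le_divide_eq_1_pos)
    qed
    finally show ?thesis using a_ge[of i] s unfolding J_def by linarith
  qed
  then have J_inj: "inj_on J {..<T}"
    by (intro linorder_inj_onI) (auto dest: J_less)
  have count: "symbol_count n X p (J i) \<ge> s" if i: "i < T" for i
  proof -
    have "(i + 1) * s \<le> T * s" using i by (intro mult_right_mono) auto
    then have le: "i * s + s \<le> m" by (simp add: m_def)
    have "{i * s..<i * s + s} \<subseteq> {x \<in> X. pmf p x \<in> prob_interval n (J i)}"
    proof
      fix x assume x: "x \<in> {i * s..<i * s + s}"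
      then have xm: "x < m" using le by simp
      have "x div s = i" using x s by (intro div_nat_eqI) (auto simp: algebra_simps)
      then have "pmf p x = (a i)^2 * u"
        using xm W u by (simp add: p w_def a_def power_divide)
      \<comment> \<open>Nonnegativity of \<open>J i - 1\<close> is what lets squaring preserve the
        strict lower bound.\<close>
      moreover have "real (J i) - 1 < a i" "a i \<le> real (J i)" "0 \<le> real (J i) - 1"
        using a_ge[of i] s J_ge[of i] unfolding J_def by linarith+
      then have "(real (J i) - 1)^2 < (a i)^2" "(a i)^2 \<le> (real (J i))^2"
        using a_ge[of i] by (auto intro!: power_strict_mono power_mono)
      ultimately show "x \<in> {x \<in> X. pmf p x \<in> prob_interval n (J i)}"
        using xm u by (auto simp: X_def prob_interval_def simp flip: u_def intro: mult_right_mono)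
    qed
    from card_mono[OF _ this] show ?thesis
      by (simp add: symbol_count_def X_def)
  qed
  \<comment> \<open>The factor \<open>ln 2\<close> serves both arguments of \<open>min\<close>: it
    is below 1 for the count and at most \<open>ln n\<close> for the cap.\<close>
  have "ln 2 * (real T * real s) = (\<Sum>i<T. ln 2 * real s)" by simp
  also have "\<dots> \<le> (\<Sum>i<T. min (real (symbol_count n X p (J i))) (real (J i) * ln (real n)))"
  proof (intro sum_mono min.boundedI)
    fix i assume "i \<in> {..<T}"
    moreover have "ln 2 * real s \<le> 1 * real s"
      using ln_2_less_1 by (intro mult_right_mono) auto
    ultimately show "ln 2 * real s \<le> real (symbol_count n X p (J i))"
      using count[of i] by simp
    have "real s * ln 2 \<le> real (J i) * ln (real n)"
      using J_ge[of i] n by (intro mult_mono) auto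
    then show "ln 2 * real s \<le> real (J i) * ln (real n)" by (simp add: mult.commute)
  qed
  also have "\<dots> = (\<Sum>j\<in>J ` {..<T}. min (real (symbol_count n X p j)) (real j * ln (real n)))"
    using J_inj by (simp add: sum.reindex)
  also have "\<dots> \<le> HS n X p"
  proof (rule sum_le_HS[OF n])
    show "J ` {..<T} \<subseteq> {1..}" using J_ge s by (auto intro: order.trans)
  qed simp
  finally show ?thesis using hist by (intro exI[of _ X] exI[of _ p]) (auto simp: X_def)
qed

section \<open>Choosing the number and size of the blocks\<close>

text \<open>Real parameters \<open>\<tau>\<close> and \<open>A\<close> with
  \<open>\<tau> * A^3 = N\<close> are rounded down to \<open>T\<close> and \<open>s\<close>. The cap
  \<open>\<tau> \<le> N powr (1/4)\<close> is equivalent to \<open>\<tau> \<le> A\<close>, so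
  \<open>s + T - 1\<close> is at most \<open>2 * A\<close>; the square of this 2 is the 4 in
  \<open>N\<close>.\<close>

lemma block_parameters:
  fixes t n :: nat
  assumes t: "t \<ge> 1" and n: "n \<ge> 2"
  obtains T s :: nat where "1 \<le> T" "T \<le> t" "1 \<le> s"
    "real T * real s * (real s + real T - 1)^2 * ln (real n) \<le> real n"
    "min ((real n * (real t)^2) powr (1/3)) (sqrt (real n)) / (16 * (1 + ln (real n)))
       \<le> real T * real s"
proof -
  define L where "L = 1 + ln (real n)"
  define M where "M = min ((real n * (real t)^2) powr (1/3)) (sqrt (real n))"
  define N where "N = real n / (4 * L)"
  have L: "L \<ge> 1" using n by (simp add: L_def)
  have n_eq: "real n = 4 * L * N" using L by (simp add: N_def)
  show ?thesis
  proof (cases "N < 1")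
    \<comment> \<open>Here \<open>n \<le> 4 * L^2\<close>, so the target is at most 1 and a single
      block with one symbol suffices.\<close>
    case True
    have "M \<le> sqrt (real n)" by (simp add: M_def)
    also have "\<dots> \<le> sqrt ((2 * L)^2)"
    proof (rule real_sqrt_le_mono)
      have "4 * L * N \<le> 4 * L * L" using True L by (intro mult_left_mono) auto
      then show "real n \<le> (2 * L)^2" by (simp add: n_eq power2_eq_square)
    qed
    also have "\<dots> = 2 * L" using L by (simp only: real_sqrt_abs)
    also have "\<dots> \<le> 16 * L" using L by simp
    finally have "M / (16 * L) \<le> 1" using L by simp
    moreover have "ln (real n) \<le> real n" using ln_bound[of "real n"] n by simp
    ultimately show ?thesis
      using t that[of 1 1] by (simp add: M_def L_def)
  next
    case False
    then have N: "N \<ge> 1" by simp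
    define \<tau> where "\<tau> = min (real t) (N powr (1/4))"
    define A where "A = (N / \<tau>) powr (1/3)"
    have N4: "N powr (1/4) \<ge> 1" using N by (simp add: ge_one_powr_ge_zero)
    have tau: "\<tau> \<ge> 1" "\<tau> \<le> real t" "\<tau> \<le> N powr (1/4)"
      using t N4 by (auto simp: \<tau>_def)
    have "N powr (1/4) = (N / N powr (1/4)) powr (1/3)"
    proof -
      have "N / N powr (1/4) = N powr (3/4)" using N powr_diff[of N 1 "1/4"] by simp
      then show ?thesis by (simp add: powr_powr)
    qed
    also have "\<dots> \<le> A"
      unfolding A_def using tau N by (intro powr_mono2 divide_left_mono) auto
    finally have A_ge: "N powr (1/4) \<le> A" .
    have A3: "A ^ 3 = N / \<tau>"
      using N tau by (simp add: A_def powr_power)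
    define T where "T = nat \<lfloor>\<tau>\<rfloor>"
    define s where "s = nat \<lfloor>A\<rfloor>"
    \<comment> \<open>Rounding down a real that is at least 1 loses at most a factor 2. The two
      roundings cost 4, which turns \<open>4 * L\<close> into \<open>16 * L\<close>.\<close>
    have nat_floor: "real (nat \<lfloor>x\<rfloor>) \<le> x \<and> x / 2 \<le> real (nat \<lfloor>x\<rfloor>) \<and> 1 \<le> nat \<lfloor>x\<rfloor>"
      if "x \<ge> 1" for x :: real
    proof -
      have 1: "1 \<le> nat \<lfloor>x\<rfloor>" using that by (simp add: le_nat_iff)
      have "real (nat \<lfloor>x\<rfloor>) \<le> x" "x < real (nat \<lfloor>x\<rfloor>) + 1"
        using that by (auto simp: of_nat_floor)
      with 1 show ?thesis by linarith
    qed
    have T: "real T \<le> \<tau>" "\<tau> / 2 \<le> real T" "1 \<le> T"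
      using nat_floor[OF tau(1)] by (auto simp: T_def)
    have A1: "A \<ge> 1" using A_ge N4 by linarith
    have s: "real s \<le> A" "A / 2 \<le> real s" "1 \<le> s"
      using nat_floor[OF A1] by (auto simp: s_def)
    have small: "real T * real s * (real s + real T - 1)^2 * ln (real n) \<le> real n"
    proof -
      have "real s + real T - 1 \<le> 2 * A" using s T tau A_ge by linarith
      then have "real T * real s * (real s + real T - 1)^2 * ln (real n) \<le> \<tau> * A * (2 * A)^2 * L"
        using s T n tau A1 by (intro mult_mono power_mono) (auto simp: L_def)
      also have "\<dots> = 4 * L * (\<tau> * A ^ 3)" by (simp add: power2_eq_square power3_eq_cube)
      also have "\<dots> = real n" using tau by (simp add: A3 n_eq)
      finally show ?thesis .
    qed
    have tau_A: "\<tau> * A = (N * \<tau>^2) powr (1/3)"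
    proof -
      have "\<tau> * A = (\<tau> ^ 3) powr (1/3) * A"
        using tau powr_powr[of \<tau> 3 "1/3"] by simp
      also have "\<dots> = (\<tau> ^ 3 * (N / \<tau>)) powr (1/3)"
        unfolding A_def by (rule powr_mult[symmetric])
      also have "\<tau> ^ 3 * (N / \<tau>) = N * \<tau>^2"
        using tau by (simp add: power2_eq_square power3_eq_cube)
      finally show ?thesis .
    qed
    \<comment> \<open>Replacing \<open>n\<close> by \<open>N\<close> inside a power with exponent
      \<open>e \<le> 1\<close> costs at most one full factor \<open>4 * L\<close>, because
      \<open>1 / (4 * L) \<le> 1\<close>.\<close>
    have L4: "1 / (4 * L) \<le> (1 / (4 * L)) powr e" if "0 \<le> e" "e \<le> 1" for e
      using powr_mono'[of e 1 "1 / (4 * L)"] that L by simp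
    have "M / (4 * L) \<le> \<tau> * A"
    \<comment> \<open>The two cases match the two terms of the minimum: \<open>\<tau> = t\<close>
      gives the cube root, \<open>\<tau> = N powr (1/4)\<close> the square root.\<close>
    proof (cases "real t \<le> N powr (1/4)")
      case True
      have "M / (4 * L) \<le> (real n * (real t)^2) powr (1/3) * (1 / (4 * L))"
        using L by (simp add: M_def divide_right_mono)
      also have "\<dots> \<le> (real n * (real t)^2) powr (1/3) * (1 / (4 * L)) powr (1/3)"
        by (intro mult_left_mono L4) auto
      also have "\<dots> = (N * (real t)^2) powr (1/3)"
        using L by (simp add: N_def flip: powr_mult)
      also have "\<dots> = \<tau> * A" using True unfolding tau_A by (simp add: \<tau>_def)
      finally show ?thesis .
    next
      case False
      have "M / (4 * L) \<le> real n powr (1/2) * (1 / (4 * L))"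
        using L by (simp add: M_def divide_right_mono powr_half_sqrt)
      also have "\<dots> \<le> real n powr (1/2) * (1 / (4 * L)) powr (1/2)"
        by (intro mult_left_mono L4) auto
      also have "\<dots> = N powr (1/2)"
        using L by (simp add: N_def flip: powr_mult)
      also have "\<dots> = (N powr (1 + 1/2)) powr (1/3)" by (simp add: powr_powr)
      also have "N powr (1 + 1/2) = N * (N powr (1/4))^2"
        using N by (subst powr_add) (simp add: powr_power)
      also have "\<dots> powr (1/3) = \<tau> * A" using False unfolding tau_A by (simp add: \<tau>_def)
      finally show ?thesis .
    qed
    moreover have "\<tau> / 2 * (A / 2) \<le> real T * real s"
      using T s tau A1 by (intro mult_mono) auto
    ultimately have "M / (16 * L) \<le> real T * real s" by simp
    moreover have "T \<le> t" using T tau by linarith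
    ultimately show ?thesis
      using that T s small by (simp add: M_def L_def)
  qed
qed

theorem theorem19:
  "\<exists>c C :: real. c > 0 \<and> C > 0 \<and>
     (\<forall>t n :: nat. t \<ge> 1 \<longrightarrow> n \<ge> 2 \<longrightarrow>
        (\<exists>(X :: nat set) (p :: nat pmf).
           finite X \<and> histogram_distribution t X p \<and>
           HS n X p \<ge> c * min ((real n * (real t)^2) powr (1/3)) (sqrt (real n))
                        / (1 + ln (real n)) powr C))"
proof (rule exI[of _ "ln 2 / 16"], rule exI[of _ 1], intro conjI allI impI)
  \<comment> \<open>In the constant, \<open>ln 2\<close> comes from the block distribution and
    \<open>1/16\<close> from the parameters, which lose only the first power of
    \<open>1 + ln n\<close>.\<close>
  fix t n :: nat
  assume tn: "t \<ge> 1" "n \<ge> 2"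
  let ?M = "min ((real n * (real t)^2) powr (1/3)) (sqrt (real n))"
  obtain T s :: nat where Ts: "1 \<le> T" "T \<le> t" "1 \<le> s"
    "real T * real s * (real s + real T - 1)^2 * ln (real n) \<le> real n"
    "?M / (16 * (1 + ln (real n))) \<le> real T * real s"
    using block_parameters[OF tn] by blast
  obtain X :: "nat set" and p where X: "finite X" "histogram_distribution t X p"
    "HS n X p \<ge> ln 2 * (real T * real s)"
    using block_distribution[OF tn(2) Ts(1-4)] by blast
  have "ln (real n) \<ge> 0" using tn by simp
  then have "ln 2 / 16 * ?M / (1 + ln (real n)) powr 1 = ln 2 * (?M / (16 * (1 + ln (real n))))"
    by simp
  also have "\<dots> \<le> ln 2 * (real T * real s)" using Ts(5) by (intro mult_left_mono) auto
  also note X(3)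
  finally show "\<exists>(X :: nat set) p. finite X \<and> histogram_distribution t X p \<and>
      HS n X p \<ge> ln 2 / 16 * ?M / (1 + ln (real n)) powr 1"
    using X(1,2) by blast
qed auto

end
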